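(* For every order $r\in\{1,2,3,\ldots\}$, on the random model $(\Omega_n,P_n)$, \[ \sqrt{n}\left(\frac{S_{r+1,n}}{n}-\frac{1}{4^r}\right)\Rightarrow N\left(0,\,\frac{1}{3}\cdot\frac{4^r-1}{16^r}\right)\qquad (n\to\infty), \] where $\Rightarrow$ denotes convergence in distribution and $N(\mu,\sigma^2)$ is the normal distribution with mean $\mu$ and variance $\sigma^2$.
   Context: For $n\ge 1$, let $\Omega_n$ be the set of rooted plane (ordered) full binary trees with $n$ leaves (every internal node has exactly two children, left and right distinguished), so $|\Omega_n|=\frac{(2n-2)!}{n!(n-1)!}$. The random model is $\Omega_n$ with the uniform probability measure $P_n$. Horton–Strahler ordering: every leaf has order 1; an internal node whose two children have different orders $r_1\neq r_2$ has order $\max\{r_1,r_2\}$; an internal node whose two children both have order $r$ has order $r+1$. A branch of order $r$ is a maximal connected path consisting of nodes all of order $r$. For $\tau\in\Omega_n$, $S_{r,n}(\tau)$ denotes the number of branches of order $r$ in $\tau$ (so $S_{1,n}=n$). *)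

theory Defs
  imports "HOL-Probability.Probability"
begin

datatype fbtree = Leaf | Node fbtree fbtree

fun leaves :: "fbtree \<Rightarrow> nat" where
  "leaves Leaf = 1"
| "leaves (Node l r) = leaves l + leaves r"

definition Omega :: "nat \<Rightarrow> fbtree set" where
  "Omega n = {t. leaves t = n}"

fun hs_order :: "fbtree \<Rightarrow> nat" where
  "hs_order Leaf = 1"
| "hs_order (Node l r) =
     (if hs_order l = hs_order r then hs_order l + 1 else max (hs_order l) (hs_order r))"

text \<open>A node of order r has at most one child of order r, so every branch of
  order r (maximal connected path of order-r nodes) has a unique top node: a node
  of order r that is the root or whose parent has order different from r.
  branches_aux r p t counts such top nodes in t, where p is the order of the parent
  of the root of t (p = 0 for the root of the whole tree; all orders are >= 1).\<close>
fun branches_aux :: "nat \<Rightarrow> nat \<Rightarrow> fbtree \<Rightarrow> nat" where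
  "branches_aux r p Leaf = (if hs_order Leaf = r \<and> p \<noteq> r then 1 else 0)"
| "branches_aux r p (Node a b) =
     (if hs_order (Node a b) = r \<and> p \<noteq> r then 1 else 0)
     + branches_aux r (hs_order (Node a b)) a + branches_aux r (hs_order (Node a b)) b"

definition S :: "nat \<Rightarrow> fbtree \<Rightarrow> nat" where
  "S r t = branches_aux r 0 t"

definition P :: "nat \<Rightarrow> fbtree pmf" where
  "P n = pmf_of_set (Omega n)"

end

theory Submission
  imports Defs "HOL-Computational_Algebra.Formal_Power_Series" "HOL-Real_Asymp.Real_Asymp"
begin

text \<open>
  Pruning (deleting all leaves and contracting the nodes with one child) lowers every
  Horton--Strahler order by one, so \<open>S (r + 1) t = S r (prune t)\<close>. Every tree with \<open>m\<close> leaves is the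
  pruning of the same number \<open>2^(n - 2m) * (n - 2 choose 2m - 2)\<close> of trees with \<open>n\<close> leaves, so given
  its number \<open>M\<close> of leaves the pruned tree is again uniform. The probabilities of consecutive values
  of \<open>M\<close> have a rational ratio, which by summation by parts gives, for \<open>Y = M - n/4\<close>, a Stein
  identity \<open>E[Y f(Y)] = E[W (f(Y + 1) - f(Y))] + c E[f(Y)]\<close> with \<open>W\<close> close to \<open>n/16\<close> and \<open>c\<close>
  bounded. The choice \<open>f = Y\<close> yields \<open>E Y\<^sup>2 \<le> n\<close>, and \<open>f = exp(i \<theta> Y)\<close> shows that
  \<open>\<psi>(\<theta>) = E exp(i \<theta> Y)\<close> satisfies \<open>\<psi>' = - (n/16) \<theta> \<psi> + O(1)\<close> for \<open>|\<theta>| sqrt n\<close> bounded, whence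
  \<open>\<psi>(\<theta>) = exp(- n \<theta>\<^sup>2/32) + O(\<theta>)\<close>. Conditioning on the size of the pruned tree propagates this to
  all orders, with limit variances \<open>v(r + 1) = v(r)/4 + 1/16^(r + 1)\<close>, and Levy's continuity theorem
  concludes.
\<close>

subsection \<open>Gaussian approximation of characteristic functions\<close>

definition gauss :: "real \<Rightarrow> real \<Rightarrow> real" where
  "gauss v x = exp (- (v * x\<^sup>2 / 2))"

lemma gauss_0_left [simp]: "gauss 0 x = 1"
  and gauss_0_right [simp]: "gauss v 0 = 1"
  by (simp_all add: gauss_def)

lemma gauss_add_left: "gauss (v + w) x = gauss v x * gauss w x"
  by (simp add: gauss_def algebra_simps add_divide_distrib flip: exp_add)

lemma gauss_divide_right: "gauss v (x / c) = gauss (v / c\<^sup>2) x"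
  by (simp add: gauss_def power_divide)

lemma gauss_pos: "gauss v x > 0"
  by (simp add: gauss_def)

lemma gauss_minus_mult: "gauss (- v) x * gauss v x = 1"
  by (simp flip: gauss_add_left)

lemma abs_gauss_le_1: "v \<ge> 0 \<Longrightarrow> \<bar>gauss v x\<bar> \<le> 1"
  by (simp add: gauss_def)

lemma has_real_derivative_gauss: "(gauss v has_real_derivative - v * x * gauss v x) (at x)"
  unfolding gauss_def by (auto intro!: derivative_eq_intros)

lemma abs_gauss_diff_le:
  assumes "v \<ge> 0" "w \<ge> 0"
  shows "\<bar>gauss v x - gauss w x\<bar> \<le> \<bar>v - w\<bar> * x\<^sup>2 / 2"
proof -
  have ordered: "\<bar>gauss v x - gauss w x\<bar> \<le> (w - v) * x\<^sup>2 / 2" if "0 \<le> v" "v \<le> w" for v w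
  proof -
    have split: "gauss w x = gauss v x * gauss (w - v) x"
      by (simp flip: gauss_add_left)
    have "\<bar>gauss v x - gauss w x\<bar> = \<bar>gauss v x\<bar> * \<bar>1 - gauss (w - v) x\<bar>"
      unfolding split by (simp add: right_diff_distrib flip: abs_mult)
    also have "\<dots> \<le> 1 * \<bar>1 - gauss (w - v) x\<bar>"
      using that by (intro mult_right_mono abs_gauss_le_1) auto
    also have "\<dots> \<le> (w - v) * x\<^sup>2 / 2"
      using that exp_ge_add_one_self[of "- ((w - v) * x\<^sup>2 / 2)"] by (simp add: gauss_def)
    finally show ?thesis .
  qed
  show ?thesis
    using ordered[of v w] ordered[of w v] assms by (cases "v \<le> w") (auto simp: abs_minus_commute)
qed

lemma norm_gauss_diff_le:
  assumes "v \<ge> 0" "w \<ge> 0"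
  shows "norm (of_real (gauss v x) - of_real (gauss w x) :: complex) \<le> \<bar>v - w\<bar> * x\<^sup>2 / 2"
  using abs_gauss_diff_le[OF assms, of x] by (metis norm_of_real of_real_diff)

lemma char_centered_normal:
  assumes "\<sigma> > 0"
  shows "char (density lborel (normal_density 0 \<sigma>)) x = of_real (gauss (\<sigma>\<^sup>2) x)"
proof -
  let ?N = "std_normal_distribution"
  interpret real_distribution ?N by (rule real_dist_normal_dist)
  have "distributed ?N lborel (\<lambda>x. x) std_normal_density"
    unfolding distributed_def by (simp add: distr_id2)
  from normal_density_affine[OF this, of \<sigma> 0]
  have "density lborel (normal_density 0 \<sigma>) = distr ?N lborel (\<lambda>x. \<sigma> * x)"
    using assms by (simp add: distributed_def)
  then have "char (density lborel (normal_density 0 \<sigma>)) x = char ?N (x * \<sigma>)"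
    unfolding char_def by (simp add: integral_distr mult.assoc)
  then show ?thesis
    by (simp add: char_std_normal_distribution gauss_def power_mult_distrib mult.commute)
qed

lemma norm_iexp_diff_le: "norm (iexp x - iexp y) \<le> \<bar>x - y\<bar>"
proof -
  have "iexp x - iexp y = iexp y * (iexp (x - y) - 1)"
    by (simp add: algebra_simps flip: exp_add)
  then show ?thesis
    using iexp_approx1[of "x - y" 0] by (simp add: norm_mult)
qed

lemma has_vector_derivative_iff_quotient:
  "(f has_vector_derivative f') (at x) \<longleftrightarrow> ((\<lambda>h. (f (x + h) - f x) /\<^sub>R h) \<longlongrightarrow> f') (at 0)"
proof -
  have "norm (f (x + h) - f x - h *\<^sub>R f') / norm h = norm ((f (x + h) - f x) /\<^sub>R h - f')"
    if "h \<noteq> 0" for h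
  proof -
    have "(f (x + h) - f x) /\<^sub>R h - f' = (f (x + h) - f x - h *\<^sub>R f') /\<^sub>R h"
      using that by (simp add: scaleR_diff_right)
    then show ?thesis by (simp add: divide_inverse_commute)
  qed
  then show ?thesis
    unfolding has_vector_derivative_def has_derivative_at tendsto_dist_iff[of _ f'] dist_norm
    by (auto simp: bounded_linear_scaleR_left cong: LIM_cong)
qed

lemma vector_differentiable_bound:
  fixes f :: "real \<Rightarrow> 'a :: real_normed_vector"
  assumes "convex A" "\<And>x. x \<in> A \<Longrightarrow> (f has_vector_derivative f' x) (at x within A)"
    and bound: "\<And>x. x \<in> A \<Longrightarrow> norm (f' x) \<le> B" and "x \<in> A" "y \<in> A"
  shows "norm (f x - f y) \<le> B * norm (x - y)"
proof (rule differentiable_bound[OF \<open>convex A\<close>])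
  show "(f has_derivative (\<lambda>h. h *\<^sub>R f' x)) (at x within A)" if "x \<in> A" for x
    using assms(2)[OF that] by (simp add: has_vector_derivative_def)
  show "onorm (\<lambda>h. h *\<^sub>R f' x) \<le> B" if "x \<in> A" for x
    using bound[OF that] by (intro onorm_le) (simp, metis abs_ge_zero mult.commute mult_left_mono)
qed fact+

text \<open>Multiplying by the integrating factor \<open>1 / gauss s x\<close> turns the hypothesis into a bound
  on a derivative.\<close>
lemma gauss_ode_stability:
  fixes \<psi> :: "real \<Rightarrow> complex"
  assumes deriv: "\<And>x. (\<psi> has_vector_derivative \<psi>' x) (at x)"
    and init: "\<psi> 0 = 1" and s: "s \<ge> 0"
    and bound: "\<And>x. \<bar>x\<bar> \<le> \<bar>\<theta>\<bar> \<Longrightarrow> norm (\<psi>' x + of_real (s * x) * \<psi> x) \<le> K"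
  shows "norm (\<psi> \<theta> - of_real (gauss s \<theta>)) \<le> K * \<bar>\<theta>\<bar>"
proof -
  define F where "F x = \<psi> x * of_real (gauss (- s) x)" for x
  define F' where "F' x = (\<psi>' x + of_real (s * x) * \<psi> x) * of_real (gauss (- s) x)" for x
  have F: "(F has_vector_derivative F' x) (at x)" for x
  proof -
    have "((\<lambda>x. complex_of_real (gauss (- s) x)) has_vector_derivative
        of_real (s * x * gauss (- s) x)) (at x)"
      using has_real_derivative_gauss[of "- s" x]
      by (intro has_vector_derivative_of_real)
        (simp add: has_real_derivative_iff_has_vector_derivative)
    from has_vector_derivative_mult[OF deriv this] show ?thesis
      unfolding F_def F'_def by (rule has_vector_derivative_eq_rhs) (simp add: algebra_simps)
  qed
  have "norm (F \<theta> - F 0) \<le> K * gauss (- s) \<theta> * norm (\<theta> - 0)"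
  proof (rule vector_differentiable_bound)
    show "(F has_vector_derivative F' x) (at x within cball 0 \<bar>\<theta>\<bar>)" for x
      using F by (rule has_vector_derivative_at_within)
  next
    fix x :: real assume "x \<in> cball 0 \<bar>\<theta>\<bar>"
    then have x: "\<bar>x\<bar> \<le> \<bar>\<theta>\<bar>" by simp
    then have "gauss (- s) x \<le> gauss (- s) \<theta>"
      using s by (simp add: gauss_def mult_left_mono abs_le_square_iff)
    then show "norm (F' x) \<le> K * gauss (- s) \<theta>"
      unfolding F'_def norm_mult using bound[OF x] norm_ge_zero[THEN order_trans, OF bound[OF x]]
      by (intro mult_mono) (auto simp: gauss_pos less_imp_le)
  qed auto
  then have F_bound: "norm (F \<theta> - 1) \<le> K * gauss (- s) \<theta> * \<bar>\<theta>\<bar>"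
    by (simp add: F_def init)
  have "\<psi> \<theta> - of_real (gauss s \<theta>) = (F \<theta> - 1) * of_real (gauss s \<theta>)"
    using gauss_minus_mult[of s \<theta>] by (simp add: F_def algebra_simps flip: of_real_mult)
  then have "norm (\<psi> \<theta> - of_real (gauss s \<theta>)) = norm (F \<theta> - 1) * gauss s \<theta>"
    by (simp add: norm_mult gauss_pos less_imp_le)
  also have "\<dots> \<le> K * gauss (- s) \<theta> * \<bar>\<theta>\<bar> * gauss s \<theta>"
    using F_bound by (intro mult_right_mono) (auto simp: gauss_pos less_imp_le)
  also have "\<dots> = K * \<bar>\<theta>\<bar>"
    using gauss_minus_mult[of s \<theta>] by (simp add: mult_ac)
  finally show ?thesis .
qed

lemma has_vector_derivative_integral_dominated:
  fixes f :: "real \<Rightarrow> 'a \<Rightarrow> 'b :: {banach, second_countable_topology}"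
  assumes int: "\<And>y. integrable M (f y)" and w: "integrable M w"
    and [measurable]: "f' \<in> borel_measurable M"
    and deriv: "\<And>\<omega>. \<omega> \<in> space M \<Longrightarrow> ((\<lambda>y. f y \<omega>) has_vector_derivative f' \<omega>) (at x)"
    and lipschitz: "\<And>y \<omega>. \<omega> \<in> space M \<Longrightarrow> norm (f y \<omega> - f x \<omega>) \<le> w \<omega> * \<bar>y - x\<bar>"
  shows "((\<lambda>y. integral\<^sup>L M (f y)) has_vector_derivative integral\<^sup>L M f') (at x)"
proof -
  define Q where "Q h \<omega> = (f (x + h) \<omega> - f x \<omega>) /\<^sub>R h" for h \<omega>
  have Q_tendsto: "((\<lambda>h. Q h \<omega>) \<longlongrightarrow> f' \<omega>) (at 0)" if "\<omega> \<in> space M" for \<omega>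
    using deriv[OF that] by (simp add: has_vector_derivative_iff_quotient Q_def)
  have "((\<lambda>h. integral\<^sup>L M (Q h)) \<longlongrightarrow> integral\<^sup>L M f') (at 0)"
    unfolding tendsto_at_iff_sequentially
  proof (intro allI impI)
    fix X :: "nat \<Rightarrow> real" assume X: "\<forall>i. X i \<in> UNIV - {0}" "X \<longlonglongrightarrow> 0"
    have "(\<lambda>i. integral\<^sup>L M (Q (X i))) \<longlonglongrightarrow> integral\<^sup>L M f'"
    proof (rule integral_dominated_convergence[OF _ _ w])
      show "AE \<omega> in M. (\<lambda>i. Q (X i) \<omega>) \<longlonglongrightarrow> f' \<omega>"
        using Q_tendsto X by (auto simp: tendsto_at_iff_sequentially o_def)
      show "AE \<omega> in M. norm (Q (X i) \<omega>) \<le> w \<omega>" for i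
        using lipschitz[of _ "x + X i"] X(1)
        by (auto simp: Q_def divide_inverse_commute[symmetric] divide_le_eq)
    qed (use int in \<open>auto simp: Q_def[abs_def]\<close>)
    then show "((\<lambda>h. integral\<^sup>L M (Q h)) \<circ> X) \<longlonglongrightarrow> integral\<^sup>L M f'"
      by (simp add: o_def)
  qed
  moreover have "integral\<^sup>L M (Q h) = (integral\<^sup>L M (f (x + h)) - integral\<^sup>L M (f x)) /\<^sub>R h" for h
    by (simp add: Q_def[abs_def] int)
  ultimately show ?thesis
    by (simp add: has_vector_derivative_iff_quotient)
qed

lemma (in prob_space) has_vector_derivative_expectation_iexp:
  assumes Y: "integrable M Y"
  shows "((\<lambda>x. expectation (\<lambda>\<omega>. iexp (x * Y \<omega>))) has_vector_derivative
           expectation (\<lambda>\<omega>. \<i> * of_real (Y \<omega>) * iexp (x * Y \<omega>))) (at x)"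
proof (rule has_vector_derivative_integral_dominated)
  have [measurable]: "random_variable borel Y" using Y by simp
  show "(\<lambda>\<omega>. \<i> * of_real (Y \<omega>) * iexp (x * Y \<omega>)) \<in> borel_measurable M" by measurable
  show "integrable M (\<lambda>\<omega>. iexp (y * Y \<omega>))" for y
    by (intro integrable_iexp) auto
  show "integrable M (\<lambda>\<omega>. \<bar>Y \<omega>\<bar>)" using Y by simp
  show "((\<lambda>y. iexp (y * c)) has_vector_derivative \<i> * of_real c * iexp (x * c)) (at x)" for c
    by (rule has_vector_derivative_eq_rhs[OF
          vector_diff_chain_at[of "\<lambda>x. x * c" c x iexp, unfolded o_def]])
      (auto intro!: derivative_eq_intros has_vector_derivative_iexp simp: scaleR_conv_of_real)
  show "norm (iexp (y * c) - iexp (x * c)) \<le> \<bar>c\<bar> * \<bar>y - x\<bar>" for y c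
    by (metis abs_mult left_diff_distrib mult.commute norm_iexp_diff_le)
qed

lemma (in prob_space) integrable_mult_iexp:
  assumes "integrable M B" and [measurable]: "random_variable borel Y"
  shows "integrable M (\<lambda>\<omega>. of_real (B \<omega>) * iexp (x * Y \<omega>))"
  by (rule Bochner_Integration.integrable_bound[OF assms(1)])
    (use assms(1) in \<open>auto simp: norm_mult simp del: of_real_mult\<close>)

lemma (in prob_space) norm_expectation_mult_iexp_le:
  "norm (expectation (\<lambda>\<omega>. of_real (B \<omega>) * iexp (x * Y \<omega>))) \<le> expectation (\<lambda>\<omega>. \<bar>B \<omega>\<bar>)"
  using integral_norm_bound[of M "\<lambda>\<omega>. of_real (B \<omega>) * iexp (x * Y \<omega>)"]
  by (simp add: norm_mult del: of_real_mult)

text \<open>The first hypothesis is Stein's equation for \<open>exp(i x Y)\<close> with the increment over a unit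
  step in place of the derivative; expanding \<open>exp(i x) - 1\<close> to first order gives
  \<open>\<psi>' + s x \<psi> \<approx> 0\<close> for the characteristic function \<open>\<psi>\<close> of \<open>Y\<close>.\<close>
lemma (in prob_space) norm_iexp_stein_residual_le:
  fixes Y A :: "'a \<Rightarrow> real" and c s x :: real
  assumes stein: "expectation (\<lambda>\<omega>. of_real (Y \<omega>) * iexp (x * Y \<omega>)) =
      expectation (\<lambda>\<omega>. of_real (A \<omega>) * (iexp (x * (Y \<omega> + 1)) - iexp (x * Y \<omega>)))
        + of_real c * expectation (\<lambda>\<omega>. iexp (x * Y \<omega>))"
    and Y: "random_variable borel Y" and A: "integrable M A"
  shows "norm (expectation (\<lambda>\<omega>. \<i> * of_real (Y \<omega>) * iexp (x * Y \<omega>))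
      + of_real (s * x) * expectation (\<lambda>\<omega>. iexp (x * Y \<omega>))) \<le>
    \<bar>c\<bar> + \<bar>x\<bar> * expectation (\<lambda>\<omega>. \<bar>A \<omega> - s\<bar>) + x\<^sup>2 / 2 * expectation (\<lambda>\<omega>. \<bar>A \<omega>\<bar>)"
proof -
  define \<mu> where "\<mu> B = expectation (\<lambda>\<omega>. of_real (B \<omega>) * iexp (x * Y \<omega>))" for B :: "'a \<Rightarrow> real"
  have \<mu>_diff: "\<mu> (\<lambda>\<omega>. A \<omega> - s) = \<mu> A - of_real s * \<mu> (\<lambda>_. 1)"
    using integrable_mult_iexp[OF A Y, of x] integrable_mult_iexp[OF _ Y, of "\<lambda>_. 1" x]
    by (simp add: \<mu>_def left_diff_distrib)
  define u where "u = iexp x - 1 - \<i> * of_real x"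
  have u: "norm u \<le> x\<^sup>2 / 2"
    using iexp_approx1[of x 1] by (simp add: u_def algebra_simps power2_eq_square)
  have "expectation (\<lambda>\<omega>. of_real (A \<omega>) * (iexp (x * (Y \<omega> + 1)) - iexp (x * Y \<omega>)))
      = (\<i> * of_real x + u) * \<mu> A"
    unfolding \<mu>_def integral_mult_right_zero[symmetric]
    by (intro Bochner_Integration.integral_cong) (simp_all add: u_def algebra_simps exp_add)
  then have \<mu>_Y: "\<mu> Y = (\<i> * of_real x + u) * \<mu> A + of_real c * \<mu> (\<lambda>_. 1)"
    using stein by (simp add: \<mu>_def)
  have "\<i> * \<mu> Y + of_real (s * x) * \<mu> (\<lambda>_. 1)
      = \<i> * of_real c * \<mu> (\<lambda>_. 1) - of_real x * \<mu> (\<lambda>\<omega>. A \<omega> - s) + \<i> * u * \<mu> A"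
    unfolding \<mu>_diff \<mu>_Y by (simp add: algebra_simps)
  also have "norm \<dots> \<le> \<bar>c\<bar> * 1 + \<bar>x\<bar> * expectation (\<lambda>\<omega>. \<bar>A \<omega> - s\<bar>)
      + x\<^sup>2 / 2 * expectation (\<lambda>\<omega>. \<bar>A \<omega>\<bar>)"
  proof (intro norm_triangle_mono order_trans[OF norm_triangle_ineq4] add_mono)
    have norm_\<mu>: "norm (\<mu> B) \<le> expectation (\<lambda>\<omega>. \<bar>B \<omega>\<bar>)" for B
      unfolding \<mu>_def by (rule norm_expectation_mult_iexp_le)
    show "norm (\<i> * of_real c * \<mu> (\<lambda>_. 1)) \<le> \<bar>c\<bar> * 1"
      unfolding norm_mult using norm_\<mu>[of "\<lambda>_. 1"] by (intro mult_mono) (auto simp: prob_space)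
    show "norm (of_real x * \<mu> (\<lambda>\<omega>. A \<omega> - s)) \<le> \<bar>x\<bar> * expectation (\<lambda>\<omega>. \<bar>A \<omega> - s\<bar>)"
      unfolding norm_mult using norm_\<mu> by (intro mult_mono) auto
    show "norm (\<i> * u * \<mu> A) \<le> x\<^sup>2 / 2 * expectation (\<lambda>\<omega>. \<bar>A \<omega>\<bar>)"
      unfolding norm_mult using norm_\<mu> u by (intro mult_mono) auto
  qed
  finally show ?thesis
    by (simp add: \<mu>_def mult.assoc)
qed

lemma (in prob_space) norm_expectation_iexp_diff_gauss_le:
  fixes Y A :: "'a \<Rightarrow> real" and c s :: real
  assumes stein: "\<And>x. expectation (\<lambda>\<omega>. of_real (Y \<omega>) * iexp (x * Y \<omega>)) =
      expectation (\<lambda>\<omega>. of_real (A \<omega>) * (iexp (x * (Y \<omega> + 1)) - iexp (x * Y \<omega>)))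
        + of_real c * expectation (\<lambda>\<omega>. iexp (x * Y \<omega>))"
    and Y: "integrable M Y" and A: "integrable M A" and s: "s \<ge> 0"
  shows "norm (expectation (\<lambda>\<omega>. iexp (\<theta> * Y \<omega>)) - of_real (gauss s \<theta>)) \<le>
    (\<bar>c\<bar> + \<bar>\<theta>\<bar> * expectation (\<lambda>\<omega>. \<bar>A \<omega> - s\<bar>) + \<theta>\<^sup>2 / 2 * expectation (\<lambda>\<omega>. \<bar>A \<omega>\<bar>)) * \<bar>\<theta>\<bar>"
proof (rule gauss_ode_stability[OF has_vector_derivative_expectation_iexp[OF Y] _ s])
  fix x :: real assume x: "\<bar>x\<bar> \<le> \<bar>\<theta>\<bar>"
  have "norm (expectation (\<lambda>\<omega>. \<i> * of_real (Y \<omega>) * iexp (x * Y \<omega>))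
      + of_real (s * x) * expectation (\<lambda>\<omega>. iexp (x * Y \<omega>)))
      \<le> \<bar>c\<bar> + \<bar>x\<bar> * expectation (\<lambda>\<omega>. \<bar>A \<omega> - s\<bar>) + x\<^sup>2 / 2 * expectation (\<lambda>\<omega>. \<bar>A \<omega>\<bar>)"
    using Y A by (intro norm_iexp_stein_residual_le stein) auto
  also have "\<dots> \<le> \<bar>c\<bar> + \<bar>\<theta>\<bar> * expectation (\<lambda>\<omega>. \<bar>A \<omega> - s\<bar>) + \<theta>\<^sup>2 / 2 * expectation (\<lambda>\<omega>. \<bar>A \<omega>\<bar>)"
    using x by (intro add_mono mult_right_mono divide_right_mono) (auto simp: abs_le_square_iff)
  finally show "norm (expectation (\<lambda>\<omega>. \<i> * of_real (Y \<omega>) * iexp (x * Y \<omega>))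
      + of_real (s * x) * expectation (\<lambda>\<omega>. iexp (x * Y \<omega>)))
      \<le> \<bar>c\<bar> + \<bar>\<theta>\<bar> * expectation (\<lambda>\<omega>. \<bar>A \<omega> - s\<bar>) + \<theta>\<^sup>2 / 2 * expectation (\<lambda>\<omega>. \<bar>A \<omega>\<bar>)" .
qed (simp add: prob_space)

lemma (in prob_space) norm_expectation_mult_diff_le:
  fixes Z W :: "'a \<Rightarrow> complex" and g h :: complex
  assumes Z: "random_variable borel Z" "\<And>\<omega>. norm (Z \<omega>) \<le> 1"
    and W: "integrable M W" and g: "norm g \<le> 1"
  shows "norm (expectation (\<lambda>\<omega>. Z \<omega> * W \<omega>) - h * g) \<le>
    expectation (\<lambda>\<omega>. norm (W \<omega> - g)) + norm (expectation Z - h)"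
proof -
  have int_Z: "integrable M Z"
    by (rule integrable_const_bound[of _ 1]) (use Z in auto)
  have norm_mult_le: "norm (Z \<omega> * w) \<le> norm w" for \<omega> w
    using Z(2)[of \<omega>] by (simp add: norm_mult mult_left_le_one_le)
  have int_ZW: "integrable M (\<lambda>\<omega>. Z \<omega> * W \<omega>)"
    by (rule Bochner_Integration.integrable_bound[OF W]) (use Z W norm_mult_le in auto)
  have "expectation (\<lambda>\<omega>. Z \<omega> * W \<omega>) - h * g
      = expectation (\<lambda>\<omega>. Z \<omega> * (W \<omega> - g)) + (expectation Z - h) * g"
    using int_Z int_ZW by (simp add: right_diff_distrib left_diff_distrib)
  also have "norm \<dots> \<le> norm (expectation (\<lambda>\<omega>. Z \<omega> * (W \<omega> - g))) + norm (expectation Z - h) * norm g"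
    by (rule order_trans[OF norm_triangle_ineq]) (simp add: norm_mult)
  also have "\<dots> \<le> expectation (\<lambda>\<omega>. norm (W \<omega> - g)) + norm (expectation Z - h) * 1"
  proof (intro add_mono mult_left_mono g)
    have "norm (expectation (\<lambda>\<omega>. Z \<omega> * (W \<omega> - g))) \<le> expectation (\<lambda>\<omega>. norm (Z \<omega> * (W \<omega> - g)))"
      by (rule integral_norm_bound)
    also have "\<dots> \<le> expectation (\<lambda>\<omega>. norm (W \<omega> - g))"
      using int_Z int_ZW W by (intro integral_mono norm_mult_le) (auto simp: right_diff_distrib)
    finally show "norm (expectation (\<lambda>\<omega>. Z \<omega> * (W \<omega> - g))) \<le> expectation (\<lambda>\<omega>. norm (W \<omega> - g))" .
  qed auto
  finally show ?thesis by simp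
qed

lemma (in prob_space) expectation_abs_le_sqrt:
  fixes Y :: "'a \<Rightarrow> real"
  assumes "random_variable borel Y" "integrable M (\<lambda>\<omega>. (Y \<omega>)\<^sup>2)"
  shows "expectation (\<lambda>\<omega>. \<bar>Y \<omega>\<bar>) \<le> sqrt (expectation (\<lambda>\<omega>. (Y \<omega>)\<^sup>2))"
  using variance_positive[of "\<lambda>\<omega>. \<bar>Y \<omega>\<bar>"] variance_eq[of "\<lambda>\<omega>. \<bar>Y \<omega>\<bar>"]
    square_integrable_imp_integrable[OF assms] assms(2)
  by (intro real_le_rsqrt) auto

subsection \<open>Discrete distributions\<close>

lemma expectation_bind_pmf_finite:
  fixes h :: "'b \<Rightarrow> 'c :: {banach, second_countable_topology}"
  assumes "finite (set_pmf p)" "\<And>x. x \<in> set_pmf p \<Longrightarrow> finite (set_pmf (f x))"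
  shows "measure_pmf.expectation (bind_pmf p f) h =
    measure_pmf.expectation p (\<lambda>x. measure_pmf.expectation (f x) h)"
proof -
  have "measure_pmf.expectation (bind_pmf p f) h
      = (\<Sum>x\<in>set_pmf p. pmf p x *\<^sub>R measure_pmf.expectation (f x) h)"
    using assms by (intro pmf_expectation_bind) auto
  also have "\<dots> = measure_pmf.expectation p (\<lambda>x. measure_pmf.expectation (f x) h)"
    using assms(1) by (intro integral_measure_pmf[symmetric]) auto
  finally show ?thesis .
qed

lemma expectation_shift_of_pmf_ratio:
  fixes p :: "nat pmf" and f :: "nat \<Rightarrow> 'a :: {banach, second_countable_topology}"
  assumes "finite (set_pmf p)" and "a 0 = 0"
    and ratio: "\<And>m. a (Suc m) * pmf p (Suc m) = b m * pmf p m"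
  shows "measure_pmf.expectation p (\<lambda>m. b m *\<^sub>R f (Suc m))
    = measure_pmf.expectation p (\<lambda>m. a m *\<^sub>R f m)"
proof -
  obtain N where N: "set_pmf p \<subseteq> {..N}"
    using assms(1) finite_nat_iff_bounded_le by blast
  then have "Suc N \<notin> set_pmf p" by auto
  then have outside: "pmf p (Suc N) = 0" by (simp add: set_pmf_iff)
  have "measure_pmf.expectation p (\<lambda>m. b m *\<^sub>R f (Suc m)) = (\<Sum>m\<le>N. (b m * pmf p m) *\<^sub>R f (Suc m))"
    using N by (subst integral_measure_pmf[of "{..N}"]) (auto simp: mult.commute)
  also have "\<dots> = (\<Sum>m\<le>Suc N. (a m * pmf p m) *\<^sub>R f m)"
    unfolding sum.atMost_Suc_shift by (simp add: ratio \<open>a 0 = 0\<close>)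
  also have "\<dots> = measure_pmf.expectation p (\<lambda>m. a m *\<^sub>R f m)"
    using N by (subst integral_measure_pmf[of "{..N}"]) (auto simp: mult.commute outside)
  finally show ?thesis .
qed

lemma pmf_map_pmf_eq_card_mult:
  assumes "\<And>s t. k s = k t \<Longrightarrow> pmf q s = pmf q t" "\<And>j. finite {s. k s = j}"
  shows "pmf (map_pmf k q) (k s) = real (card {t. k t = k s}) * pmf q s"
proof -
  have "pmf (map_pmf k q) (k s) = measure q {t. k t = k s}"
    by (simp add: pmf_map vimage_def)
  also have "\<dots> = (\<Sum>t | k t = k s. pmf q t)"
    using assms(2) by (rule measure_measure_pmf_finite)
  also have "\<dots> = (\<Sum>t | k t = k s. pmf q s)"
    by (intro sum.cong refl assms(1)) simp
  finally show ?thesis by simp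
qed

lemma pmf_eq_bind_pmf_of_set_fibre:
  assumes const: "\<And>s t. k s = k t \<Longrightarrow> pmf q s = pmf q t" and fin: "\<And>j. finite {s. k s = j}"
  shows "q = bind_pmf (map_pmf k q) (\<lambda>j. pmf_of_set {s. k s = j})"
proof (rule pmf_eqI)
  fix s
  define B where "B j = {t. k t = j}" for j
  have "pmf (pmf_of_set (B j)) s = indicator {k s} j / real (card (B (k s)))"
    if "j \<in> set_pmf (map_pmf k q)" for j
    using that fin by (subst pmf_of_set) (auto simp: B_def split: split_indicator)
  then have "pmf (bind_pmf (map_pmf k q) (\<lambda>j. pmf_of_set (B j))) s
      = measure_pmf.expectation (map_pmf k q) (\<lambda>j. indicator {k s} j / real (card (B (k s))))"
    unfolding pmf_bind by (intro integral_cong_AE) (auto simp: AE_measure_pmf_iff)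
  also have "\<dots> = pmf (map_pmf k q) (k s) / real (card (B (k s)))"
    by (simp add: measure_pmf_single del: integral_map_pmf)
  also have "\<dots> = pmf q s"
  proof -
    have "card (B (k s)) > 0" using fin[of "k s"] by (auto simp: B_def card_gt_0_iff)
    then show ?thesis
      using pmf_map_pmf_eq_card_mult[of k q s, OF const fin] by (simp add: B_def)
  qed
  finally show "pmf q s = pmf (bind_pmf (map_pmf k q) (\<lambda>j. pmf_of_set {s. k s = j})) s"
    by (simp add: B_def)
qed

subsection \<open>Pruning\<close>

text \<open>The value at \<open>Leaf\<close> is junk: its pruning is the empty tree.\<close>
fun prune :: "fbtree \<Rightarrow> fbtree" where
  "prune Leaf = Leaf"
| "prune (Node l r) =
     (if l = Leaf then prune r else if r = Leaf then prune l else Node (prune l) (prune r))"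

lemma hs_order_pos: "hs_order t > 0"
  by (induction t) auto

lemma hs_order_Node_ge_2: "hs_order (Node l r) \<ge> 2"
  using hs_order_pos[of l] hs_order_pos[of r] by (auto simp: max_def)

lemma hs_order_Node_Leaf:
  assumes "t \<noteq> Leaf"
  shows "hs_order (Node Leaf t) = hs_order t" "hs_order (Node t Leaf) = hs_order t"
proof -
  have "hs_order t \<ge> 2"
    using assms hs_order_Node_ge_2 by (cases t) (auto simp del: hs_order.simps)
  then show "hs_order (Node Leaf t) = hs_order t" "hs_order (Node t Leaf) = hs_order t"
    by (simp_all add: max_def)
qed

lemma hs_order_prune: "t \<noteq> Leaf \<Longrightarrow> hs_order t = Suc (hs_order (prune t))"
proof (induction t rule: prune.induct)
  case (2 l r)
  then show ?case
    by (cases "l = Leaf"; cases "r = Leaf")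
       (simp_all add: hs_order_Node_Leaf del: hs_order.simps(2), simp_all add: max_def)
qed simp

lemma branches_aux_root:
  "branches_aux r p t = (if hs_order t = r \<and> p \<noteq> r then 1 else 0) + branches_aux r (hs_order t) t"
  by (cases t) auto

lemma branches_aux_Node_Leaf:
  assumes "t \<noteq> Leaf" "r \<noteq> 1"
  shows "branches_aux r p (Node Leaf t) = branches_aux r p t"
    and "branches_aux r p (Node t Leaf) = branches_aux r p t"
  using assms branches_aux_root[of r p t]
  by (simp_all add: hs_order_Node_Leaf del: hs_order.simps(2))

lemma branches_aux_prune:
  assumes "t \<noteq> Leaf" "r > 0" "p = Suc r \<longleftrightarrow> q = r"
  shows "branches_aux (Suc r) p t = branches_aux r q (prune t)"
  using assms
proof (induction t arbitrary: p q)
  case (Node a b)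
  consider (cherry) "a = Leaf" "b = Leaf" | (left_leaf) "a = Leaf" "b \<noteq> Leaf"
    | (right_leaf) "a \<noteq> Leaf" "b = Leaf" | (surviving) "a \<noteq> Leaf" "b \<noteq> Leaf"
    by blast
  then show ?case
  proof cases
    case cherry
    then show ?thesis using Node.prems by simp
  next
    case left_leaf
    have "branches_aux (Suc r) p b = branches_aux r q (prune b)"
      using left_leaf Node.prems by (intro Node.IH(2))
    then show ?thesis
      using left_leaf \<open>r > 0\<close> by (simp add: branches_aux_Node_Leaf del: branches_aux.simps)
  next
    case right_leaf
    have "branches_aux (Suc r) p a = branches_aux r q (prune a)"
      using right_leaf Node.prems by (intro Node.IH(1))
    then show ?thesis
      using right_leaf \<open>r > 0\<close> by (simp add: branches_aux_Node_Leaf del: branches_aux.simps)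
  next
    case surviving
    define h where "h = hs_order (Node (prune a) (prune b))"
    have order: "hs_order (Node a b) = Suc h"
      using hs_order_prune[of "Node a b"] surviving by (simp add: h_def)
    have subtrees: "branches_aux (Suc r) (Suc h) a = branches_aux r h (prune a)"
      "branches_aux (Suc r) (Suc h) b = branches_aux r h (prune b)"
      using surviving Node.prems by (auto intro!: Node.IH)
    have "prune (Node a b) = Node (prune a) (prune b)"
      using surviving by simp
    then show ?thesis
      using Node.prems(3) by (simp only: branches_aux.simps order subtrees flip: h_def) simp
  qed
qed simp

lemma S_Suc_prune:
  assumes "t \<noteq> Leaf" "r > 0"
  shows "S (Suc r) t = S r (prune t)"
  unfolding S_def using assms by (intro branches_aux_prune) auto

lemma S_1_eq_leaves: "S 1 t = leaves t"
proof -
  have "p \<noteq> 1 \<Longrightarrow> branches_aux 1 p t = leaves t" for p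
  proof (induction t arbitrary: p)
    case (Node a b)
    then show ?case using hs_order_Node_ge_2[of a b] unfolding branches_aux.simps by auto
  qed auto
  then show ?thesis by (simp add: S_def)
qed

lemma leaves_pos: "leaves t > 0"
  by (induction t) auto

lemma leaves_neq_0 [simp]: "leaves t \<noteq> 0"
  using leaves_pos[of t] by linarith

lemma leaves_eq_1_iff [simp]: "leaves t = Suc 0 \<longleftrightarrow> t = Leaf"
  using leaves_pos by (cases t) (auto simp: add_is_1)

lemma leaves_prune_le: "t \<noteq> Leaf \<Longrightarrow> 2 * leaves (prune t) \<le> leaves t"
proof (induction t)
  case (Node l r)
  then show ?case
    using leaves_pos[of l] leaves_pos[of r] by (cases "l = Leaf"; cases "r = Leaf") auto
qed simp

subsection \<open>Generating functions of classes of trees\<close>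

lemma mem_Omega: "t \<in> Omega n \<longleftrightarrow> leaves t = n"
  by (simp add: Omega_def)

lemma Omega_0 [simp]: "Omega 0 = {}"
  by (auto simp: mem_Omega)

lemma Omega_1 [simp]: "Omega (Suc 0) = {Leaf}"
  by (auto simp: mem_Omega)

lemma finite_Omega [simp]: "finite (Omega n)"
proof -
  have "finite {t. leaves t \<le> n}"
  proof (induction n)
    case (Suc n)
    let ?T = "{t. leaves t \<le> n}"
    have "t \<in> insert Leaf ((\<lambda>(a, b). Node a b) ` (?T \<times> ?T))" if "leaves t \<le> Suc n" for t
    proof (cases t)
      case (Node a b)
      then show ?thesis using that leaves_pos[of a] leaves_pos[of b] by auto
    qed simp
    then have "{t. leaves t \<le> Suc n} \<subseteq> insert Leaf ((\<lambda>(a, b). Node a b) ` (?T \<times> ?T))"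
      by blast
    then show ?case
      by (rule finite_subset) (use Suc in auto)
  qed simp
  then show ?thesis
    by (rule rev_finite_subset) (auto simp: mem_Omega)
qed

definition node_set :: "fbtree set \<Rightarrow> fbtree set \<Rightarrow> fbtree set" where
  "node_set A B = {Node a b | a b. a \<in> A \<and> b \<in> B}"

lemma Node_mem_node_set [simp]: "Node a b \<in> node_set A B \<longleftrightarrow> a \<in> A \<and> b \<in> B"
  and Leaf_notin_node_set [simp]: "Leaf \<notin> node_set A B"
  by (auto simp: node_set_def)

definition tree_gf :: "fbtree set \<Rightarrow> real fps" where
  "tree_gf A = Abs_fps (\<lambda>n. real (card (A \<inter> Omega n)))"

lemma fps_nth_tree_gf [simp]: "fps_nth (tree_gf A) n = real (card (A \<inter> Omega n))"
  by (simp add: tree_gf_def)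

lemma tree_gf_Leaf: "tree_gf {Leaf} = fps_X"
  by (rule fps_ext) (auto simp: mem_Omega fps_X_nth card_insert_if Int_insert_left)

lemma tree_gf_Un:
  assumes "A \<inter> B = {}"
  shows "tree_gf (A \<union> B) = tree_gf A + tree_gf B"
proof (rule fps_ext)
  fix n
  have "card ((A \<union> B) \<inter> Omega n) = card (A \<inter> Omega n) + card (B \<inter> Omega n)"
    unfolding Int_Un_distrib2 using assms by (intro card_Un_disjoint) auto
  then show "fps_nth (tree_gf (A \<union> B)) n = fps_nth (tree_gf A + tree_gf B) n"
    by simp
qed

lemma tree_gf_node_set: "tree_gf (node_set A B) = tree_gf A * tree_gf B"
proof (rule fps_ext)
  fix n
  let ?T = "\<Union>i\<in>{0..n}. (A \<inter> Omega i) \<times> (B \<inter> Omega (n - i))"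
  have "node_set A B \<inter> Omega n = (\<lambda>(a, b). Node a b) ` ?T"
    by (force simp: node_set_def mem_Omega)
  then have "card (node_set A B \<inter> Omega n) = card ?T"
    by (simp add: card_image inj_on_def)
  also have "\<dots> = (\<Sum>i=0..n. card ((A \<inter> Omega i) \<times> (B \<inter> Omega (n - i))))"
    by (intro card_UN_disjoint) (auto simp: mem_Omega)
  finally show "fps_nth (tree_gf (node_set A B)) n = fps_nth (tree_gf A * tree_gf B) n"
    by (simp add: fps_mult_nth card_cartesian_product)
qed

lemma tree_gf_UNIV: "tree_gf UNIV = fps_X + (tree_gf UNIV)\<^sup>2"
proof -
  have "t \<in> {Leaf} \<union> node_set UNIV UNIV" for t
    by (cases t) auto
  then have "tree_gf UNIV = tree_gf ({Leaf} \<union> node_set UNIV UNIV)"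
    by (intro arg_cong[of _ _ tree_gf]) blast
  also have "\<dots> = fps_X + (tree_gf UNIV)\<^sup>2"
    by (subst tree_gf_Un) (auto simp: tree_gf_Leaf tree_gf_node_set power2_eq_square)
  finally show ?thesis .
qed

text \<open>The equation \<open>C = X + C\<^sup>2\<close> gives \<open>(1 - 4 X) C' = 1 - 2 C\<close>.\<close>
lemma card_Omega_Suc:
  assumes "n > 0"
  shows "(real n + 1) * real (card (Omega (Suc n))) = (4 * real n - 2) * real (card (Omega n))"
proof -
  define C where "C = tree_gf UNIV"
  have C: "C = fps_X + C\<^sup>2"
    unfolding C_def by (rule tree_gf_UNIV)
  have deriv: "fps_deriv C * (1 - 2 * C) = 1"
    using arg_cong[OF C, of fps_deriv] by (simp add: algebra_simps power2_eq_square)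
  have square: "(1 - 2 * C)\<^sup>2 = 1 - 4 * fps_X"
  proof -
    have "(1 - 2 * C)\<^sup>2 = 1 - 4 * (C - C\<^sup>2)" by (simp add: algebra_simps power2_eq_square)
    also have "C - C\<^sup>2 = fps_X" using C by (metis add_diff_cancel_right')
    finally show ?thesis .
  qed
  have "fps_deriv C * (1 - 4 * fps_X) = (fps_deriv C * (1 - 2 * C)) * (1 - 2 * C)"
    unfolding square[symmetric] by (simp add: power2_eq_square mult.assoc)
  then have "fps_deriv C - fps_const 4 * (fps_X * fps_deriv C) = 1 - fps_const 2 * C"
    unfolding deriv by (simp add: algebra_simps numeral_fps_const)
  from arg_cong[OF this, of "\<lambda>F. fps_nth F n"] show ?thesis
    using assms by (simp only: fps_sub_nth fps_mult_left_const_nth fps_deriv_nth fps_X_mult_nth)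
      (simp add: C_def algebra_simps)
qed

lemma Omega_nonempty:
  assumes "n > 0"
  shows "Omega n \<noteq> {}"
  using assms
proof (induction n rule: nat_induct_non_zero)
  case (Suc n)
  then obtain t where "leaves t = n" by (metis ex_in_conv mem_Omega)
  then have "Node Leaf t \<in> Omega (Suc n)" by (simp add: mem_Omega)
  then show ?case by blast
qed simp

subsection \<open>Fibres of pruning\<close>

definition prune_fibre :: "fbtree \<Rightarrow> fbtree set" where
  "prune_fibre s = {t. t \<noteq> Leaf \<and> prune t = s}"

text \<open>The trees in a fibre whose root survives pruning, or, over \<open>Leaf\<close>, the tree that contracts
  to it.\<close>
fun prune_fibre_core :: "fbtree \<Rightarrow> fbtree set" where
  "prune_fibre_core Leaf = node_set {Leaf} {Leaf}"
| "prune_fibre_core (Node a b) = node_set (prune_fibre a) (prune_fibre b)"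

lemma prune_fibre_decomp:
  "prune_fibre s =
    node_set {Leaf} (prune_fibre s) \<union> node_set (prune_fibre s) {Leaf} \<union> prune_fibre_core s"
proof (rule set_eqI)
  fix t
  show "t \<in> prune_fibre s \<longleftrightarrow>
    t \<in> node_set {Leaf} (prune_fibre s) \<union> node_set (prune_fibre s) {Leaf} \<union> prune_fibre_core s"
    by (cases t; cases s) (auto simp: prune_fibre_def)
qed

lemma tree_gf_prune_fibre_decomp:
  "(1 - fps_const 2 * fps_X) * tree_gf (prune_fibre s) = tree_gf (prune_fibre_core s)"
proof -
  let ?F = "prune_fibre s"
  have "node_set {Leaf} ?F \<inter> node_set ?F {Leaf} = {}"
    by (auto simp: node_set_def prune_fibre_def)
  moreover have "(node_set {Leaf} ?F \<union> node_set ?F {Leaf}) \<inter> prune_fibre_core s = {}"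
    by (cases s) (auto simp: node_set_def prune_fibre_def)
  ultimately have "tree_gf ?F =
      tree_gf (node_set {Leaf} ?F) + tree_gf (node_set ?F {Leaf}) + tree_gf (prune_fibre_core s)"
    by (subst prune_fibre_decomp) (simp add: tree_gf_Un)
  also have "\<dots> = fps_const 2 * fps_X * tree_gf ?F + tree_gf (prune_fibre_core s)"
    by (simp add: tree_gf_node_set tree_gf_Leaf numeral_fps_const)
  finally show ?thesis
    by (metis add_diff_cancel_left' left_diff_distrib mult_1)
qed

text \<open>The factors \<open>1 / (1 - 2 X)\<close> account for the chains of nodes with a single leaf child, each
  of which is a left or a right child.\<close>
lemma tree_gf_prune_fibre:
  "(1 - fps_const 2 * fps_X) ^ (2 * leaves s - 1) * tree_gf (prune_fibre s)
    = fps_X ^ (2 * leaves s)"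
proof (induction s)
  case Leaf
  then show ?case
    using tree_gf_prune_fibre_decomp[of Leaf]
    by (simp add: tree_gf_node_set tree_gf_Leaf power2_eq_square)
next
  case (Node a b)
  let ?D = "1 - fps_const 2 * fps_X :: real fps"
  have exponent: "2 * leaves (Node a b) - 1 = (2 * leaves a - 1) + (2 * leaves b - 1) + 1"
    using leaves_pos[of a] leaves_pos[of b] by simp
  have "?D * tree_gf (prune_fibre (Node a b)) = tree_gf (prune_fibre a) * tree_gf (prune_fibre b)"
    using tree_gf_prune_fibre_decomp[of "Node a b"]
    by (simp add: tree_gf_node_set)
  then have "?D ^ (2 * leaves (Node a b) - 1) * tree_gf (prune_fibre (Node a b))
    = (?D ^ (2 * leaves a - 1) * tree_gf (prune_fibre a))
      * (?D ^ (2 * leaves b - 1) * tree_gf (prune_fibre b))"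
    unfolding exponent power_add by (simp add: mult_ac)
  also have "\<dots> = fps_X ^ (2 * leaves (Node a b))"
    unfolding Node by (simp add: algebra_simps flip: power_add)
  finally show ?case .
qed

definition prune_fibre_size :: "nat \<Rightarrow> nat \<Rightarrow> nat" where
  "prune_fibre_size n m = (if 2 * m \<le> n then 2 ^ (n - 2 * m) * ((n - 2) choose (2 * m - 2)) else 0)"

lemma card_prune_fibre:
  "card (prune_fibre s \<inter> Omega n) = prune_fibre_size n (leaves s)"
proof -
  define k where "k = leaves s - 1"
  have leaves: "leaves s = Suc k"
    using leaves_pos[of s] by (simp add: k_def)
  let ?Q = "(1 - fps_const 2 * fps_X) ^ Suc (2 * k) :: real fps"
  have "fps_X ^ (2 * Suc k) * inverse ?Q = tree_gf (prune_fibre s) * (?Q * inverse ?Q)"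
    using tree_gf_prune_fibre[of s] by (simp add: leaves mult_ac)
  also have "?Q * inverse ?Q = 1"
    by (rule inverse_mult_eq_1') (simp add: fps_nth_power_0 del: power_Suc)
  finally have "tree_gf (prune_fibre s) =
      fps_X ^ (2 * Suc k) * Abs_fps (\<lambda>j. of_nat ((2 * k + j) choose j) * 2 ^ j)"
    by (subst (asm) one_minus_const_fps_X_neg_power') auto
  from arg_cong[OF this, of "\<lambda>F. fps_nth F n"]
  have card: "real (card (prune_fibre s \<inter> Omega n)) = (if n < 2 * Suc k then 0
      else real (2 * k + (n - 2 * Suc k) choose (n - 2 * Suc k)) * 2 ^ (n - 2 * Suc k))"
    by (simp only: fps_nth_tree_gf fps_X_power_mult_nth fps_nth_Abs_fps)
  show ?thesis
  proof (cases "n < 2 * Suc k")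
    case True
    with card show ?thesis by (simp add: prune_fibre_size_def leaves)
  next
    case False
    then have "2 * k + (n - 2 * Suc k) = n - 2" by simp
    moreover have "(n - 2) choose (n - 2 * Suc k) = (n - 2) choose (2 * k)"
      using False binomial_symmetric[of "2 * k" "n - 2"] by simp
    ultimately have "real (card (prune_fibre s \<inter> Omega n)) = real (prune_fibre_size n (leaves s))"
      using card False by (simp add: prune_fibre_size_def leaves)
    then show ?thesis by simp
  qed
qed

subsection \<open>The number of leaves after pruning\<close>

lemma set_pmf_P: "n > 0 \<Longrightarrow> set_pmf (P n) = Omega n"
  by (simp add: P_def Omega_nonempty)

lemma pmf_map_prune:
  assumes "n \<ge> 2"
  shows "pmf (map_pmf prune (P n)) s = real (prune_fibre_size n (leaves s)) / real (card (Omega n))"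
proof -
  have "Omega n \<inter> prune -` {s} = prune_fibre s \<inter> Omega n"
    using assms by (auto simp: prune_fibre_def mem_Omega)
  then show ?thesis
    using assms by (simp add: pmf_map P_def measure_pmf_of_set Omega_nonempty card_prune_fibre)
qed

definition pruned_size :: "nat \<Rightarrow> nat pmf" where
  "pruned_size n = map_pmf (\<lambda>t. leaves (prune t)) (P n)"

abbreviation size_dev :: "nat \<Rightarrow> nat \<Rightarrow> real" where
  "size_dev n m \<equiv> real m - real n / 4"

lemma pruned_size_eq_map_leaves: "pruned_size n = map_pmf leaves (map_pmf prune (P n))"
  by (simp add: pruned_size_def map_pmf_comp)

lemma map_pmf_prune:
  assumes "n \<ge> 2"
  shows "map_pmf prune (P n) = bind_pmf (pruned_size n) P"
proof -
  have "map_pmf prune (P n)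
      = bind_pmf (map_pmf leaves (map_pmf prune (P n))) (\<lambda>m. pmf_of_set {s. leaves s = m})"
    using finite_Omega
    by (intro pmf_eq_bind_pmf_of_set_fibre) (simp_all add: pmf_map_prune[OF assms] Omega_def)
  then show ?thesis
    by (simp add: pruned_size_eq_map_leaves P_def[abs_def] Omega_def)
qed

lemma pmf_pruned_size:
  assumes "n \<ge> 2"
  shows "pmf (pruned_size n) m =
    real (card (Omega m)) * real (prune_fibre_size n m) / real (card (Omega n))"
proof (cases "m = 0")
  case True
  have "0 \<notin> set_pmf (pruned_size n)"
    by (simp add: pruned_size_def image_iff)
  then show ?thesis using True by (simp add: set_pmf_iff)
next
  case False
  then obtain s where "leaves s = m"
    by (metis Omega_nonempty ex_in_conv gr0I mem_Omega)
  then show ?thesis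
    using pmf_map_pmf_eq_card_mult[of leaves "map_pmf prune (P n)" s] finite_Omega
    by (simp add: pmf_map_prune[OF assms] pruned_size_eq_map_leaves Omega_def)
qed

lemma set_pmf_pruned_size:
  assumes "n \<ge> 2" "m \<in> set_pmf (pruned_size n)"
  shows "m > 0" "2 * m \<le> n"
proof -
  from assms obtain t where t: "t \<in> Omega n" "m = leaves (prune t)"
    by (auto simp: pruned_size_def set_pmf_P)
  moreover from t have "t \<noteq> Leaf"
    using assms(1) by (auto simp: mem_Omega)
  ultimately show "m > 0" "2 * m \<le> n"
    using leaves_prune_le[of t] leaves_pos by (auto simp: mem_Omega)
qed

lemma finite_set_pmf_pruned_size [simp]: "n \<ge> 2 \<Longrightarrow> finite (set_pmf (pruned_size n))"
  by (simp add: pruned_size_def set_pmf_P)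

lemma integrable_pruned_size [simp]:
  fixes f :: "nat \<Rightarrow> 'a :: {banach, second_countable_topology}"
  assumes "n \<ge> 2"
  shows "integrable (measure_pmf (pruned_size n)) f"
  using assms by (intro integrable_measure_pmf_finite) simp

lemma expectation_pruned_size_mono:
  fixes f g :: "nat \<Rightarrow> real"
  assumes "n \<ge> 2" "\<And>m. 0 < m \<Longrightarrow> 2 * m \<le> n \<Longrightarrow> f m \<le> g m"
  shows "measure_pmf.expectation (pruned_size n) f \<le> measure_pmf.expectation (pruned_size n) g"
  using assms by (intro integral_mono_AE) (auto simp: AE_measure_pmf_iff set_pmf_pruned_size)

subsection \<open>Stein's method for the number of leaves after pruning\<close>

lemma binomial_Suc_Suc_mult:
  "Suc k * Suc (Suc k) * (n choose Suc (Suc k)) = (n - k) * (n - Suc k) * (n choose k)"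
proof -
  have step: "Suc j * (n choose Suc j) = (n - j) * (n choose j)" for j
    by (simp only: binomial_absorption binomial_absorb_comp)
  show ?thesis
    using step[of k] step[of "Suc k"] by (metis mult.assoc mult.left_commute)
qed

lemma prune_fibre_size_Suc:
  assumes "m > 0"
  shows "4 * (2 * real m * (2 * real m - 1)) * real (prune_fibre_size n (Suc m))
     = (real n - 2 * real m) * (real n - 2 * real m - 1) * real (prune_fibre_size n m)"
proof (cases "2 * Suc m \<le> n")
  case True
  then obtain d where n: "n = 2 * Suc m + d"
    using le_Suc_ex by blast
  obtain i where m: "m = Suc i"
    using assms gr0_implies_Suc by blast
  have "real (Suc (2 * i) * Suc (Suc (2 * i)) * ((2 * m + d) choose Suc (Suc (2 * i))))
      = real ((d + 2) * (d + 1) * ((2 * m + d) choose (2 * i)))"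
    unfolding binomial_Suc_Suc_mult by (simp add: m)
  then have binomials: "2 * real m * (2 * real m - 1) * real ((2 * m + d) choose (2 * m))
      = (2 + real d) * (1 + real d) * real ((2 * m + d) choose (2 * m - 2))"
    by (simp add: m algebra_simps)
  have "4 * (2 * real m * (2 * real m - 1)) * real (prune_fibre_size n (Suc m))
      = 4 * 2 ^ d * (2 * real m * (2 * real m - 1) * real ((2 * m + d) choose (2 * m)))"
    by (simp add: prune_fibre_size_def n)
  also have "\<dots> = (real n - 2 * real m) * (real n - 2 * real m - 1) * real (prune_fibre_size n m)"
    unfolding binomials by (simp add: prune_fibre_size_def n)
  finally show ?thesis .
next
  case False
  then have "n < 2 * m \<or> n = 2 * m \<or> n = 2 * m + 1" by simp linarith
  then show ?thesis
    by (elim disjE) (simp_all add: prune_fibre_size_def)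
qed

lemma pmf_pruned_size_Suc:
  assumes "n \<ge> 2"
  shows "4 * real m * (real m + 1) * pmf (pruned_size n) (Suc m)
    = (real n - 2 * real m) * (real n - 2 * real m - 1) * pmf (pruned_size n) m"
proof (cases "m = 0")
  case False
  define F where "F m = real (prune_fibre_size n m)" for m
  have trees: "(real m + 1) * real (card (Omega (Suc m)))
      = 2 * (2 * real m - 1) * real (card (Omega m))"
    using card_Omega_Suc[of m] False by (simp add: algebra_simps)
  have "4 * real m * (real m + 1) * (real (card (Omega (Suc m))) * F (Suc m))
      = 4 * real m * F (Suc m) * ((real m + 1) * real (card (Omega (Suc m))))"
    by (simp only: mult_ac)
  also have "\<dots> = 4 * (2 * real m * (2 * real m - 1)) * F (Suc m) * real (card (Omega m))"
    unfolding trees by (simp only: mult_ac)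
  also have "\<dots> = (real n - 2 * real m) * (real n - 2 * real m - 1) * (real (card (Omega m)) * F m)"
    using prune_fibre_size_Suc[of m n] False by (simp add: F_def)
  finally show ?thesis
    by (simp add: pmf_pruned_size[OF assms] F_def)
qed (simp add: pmf_pruned_size[OF assms])

definition stein_weight :: "nat \<Rightarrow> nat \<Rightarrow> real" where
  "stein_weight n m = (real n - 2 * real m) * (real n - 2 * real m - 1) / (4 * real n - 6)"

lemma pruned_size_stein_identity:
  fixes f :: "nat \<Rightarrow> 'a :: {banach, second_countable_topology}"
  assumes "n \<ge> 2"
  shows "measure_pmf.expectation (pruned_size n) (\<lambda>m. size_dev n m *\<^sub>R f m)
    = measure_pmf.expectation (pruned_size n) (\<lambda>m. stein_weight n m *\<^sub>R (f (Suc m) - f m))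
      + (real n / (8 * real n - 12)) *\<^sub>R measure_pmf.expectation (pruned_size n) f"
proof -
  let ?E = "measure_pmf.expectation (pruned_size n) :: (nat \<Rightarrow> 'a) \<Rightarrow> 'a"
  define D where "D = 4 * real n - 6"
  have D: "D > 0" using assms by (simp add: D_def)
  define a where "a m = 4 * (real m - 1) * real m / D" for m
  have weight: "stein_weight n m = (real n - 2 * real m) * (real n - 2 * real m - 1) / D" for m
    by (simp add: stein_weight_def D_def)
  have "a (Suc m) = 4 * real m * (real m + 1) / D" for m
    by (simp add: a_def algebra_simps)
  then have "a (Suc m) * pmf (pruned_size n) (Suc m) = stein_weight n m * pmf (pruned_size n) m"
    for m
    by (simp only: weight times_divide_eq_left pmf_pruned_size_Suc[OF assms])
  then have ratio: "?E (\<lambda>m. stein_weight n m *\<^sub>R f (Suc m)) = ?E (\<lambda>m. a m *\<^sub>R f m)"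
    using assms by (intro expectation_shift_of_pmf_ratio) (simp_all add: a_def)
  have c: "real n / (8 * real n - 12) = real n / 2 / D"
    by (simp add: D_def)
  have "D * size_dev n m = 4 * (real m - 1) * real m
      - (real n - 2 * real m) * (real n - 2 * real m - 1) + real n / 2" for m
    by (simp add: D_def field_simps)
  then have "size_dev n m = a m - stein_weight n m + real n / (8 * real n - 12)" for m
    using D unfolding a_def weight c
    by (simp only: eq_divide_eq mult.commute flip: add_divide_distrib diff_divide_distrib) simp
  then have "?E (\<lambda>m. size_dev n m *\<^sub>R f m)
      = ?E (\<lambda>m. a m *\<^sub>R f m - stein_weight n m *\<^sub>R f m + (real n / (8 * real n - 12)) *\<^sub>R f m)"
    by (simp only: scaleR_left_distrib scaleR_left_diff_distrib)
  also have "\<dots> = ?E (\<lambda>m. stein_weight n m *\<^sub>R (f (Suc m) - f m))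
      + (real n / (8 * real n - 12)) *\<^sub>R ?E f"
    using assms by (simp add: scaleR_right_diff_distrib ratio)
  finally show ?thesis .
qed

lemma stein_weight_nonneg:
  assumes "n \<ge> 2" "2 * m \<le> n"
  shows "stein_weight n m \<ge> 0"
proof (cases "n = 2 * m")
  case False
  then have "real n - 2 * real m \<ge> 1" using assms by linarith
  then show ?thesis using assms by (simp add: stein_weight_def)
qed (simp add: stein_weight_def)

lemma stein_weight_le:
  assumes "n \<ge> 2" "0 < m" "2 * m \<le> n"
  shows "stein_weight n m \<le> real n / 2"
proof -
  have "(real n - 2 * real m - 1) * (real n - 2 * real m) \<le> real n * (real n - 2)"
    using assms by (intro mult_mono) linarith+
  also have "\<dots> \<le> real n * ((4 * real n - 6) / 2)"
    using assms by (intro mult_left_mono) auto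
  finally show ?thesis
    using assms by (simp add: stein_weight_def divide_le_eq mult.commute)
qed

lemma abs_stein_weight_diff_le:
  assumes "n \<ge> 2" "0 < m" "2 * m \<le> n"
  shows "\<bar>stein_weight n m - real n / 16\<bar> \<le> 4 * \<bar>size_dev n m\<bar> + 1"
proof -
  define N y D where "N = real n" and "y = real m - N / 4" and "D = 16 * (4 * N - 6)"
  have N: "N \<ge> 2" using assms by (simp add: N_def)
  then have D: "D > 0" "16 * N \<le> D" by (auto simp: D_def)
  have y: "\<bar>y\<bar> \<le> N / 4"
    unfolding y_def N_def abs_le_iff using assms by linarith
  have "stein_weight n m - real n / 16 = (64 * (y * y) + 32 * y - 32 * (N * y) - 2 * N) / D"
    using D by (simp add: stein_weight_def N_def[symmetric] y_def D_def field_simps)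
  then have "\<bar>stein_weight n m - real n / 16\<bar> = \<bar>64 * (y * y) + 32 * y - 32 * (N * y) - 2 * N\<bar> / D"
    using D by simp
  also have "\<dots> \<le> (4 * \<bar>y\<bar> + 1) * (16 * N) / D"
  proof -
    have "\<bar>y * y\<bar> \<le> N / 4 * \<bar>y\<bar>"
      unfolding abs_mult using y by (intro mult_right_mono) auto
    moreover have "2 * \<bar>y\<bar> \<le> N * \<bar>y\<bar>" "\<bar>N * y\<bar> = N * \<bar>y\<bar>"
      using N by (auto simp: abs_mult intro!: mult_right_mono)
    ultimately have "\<bar>64 * (y * y) + 32 * y - 32 * (N * y) - 2 * N\<bar> \<le> 64 * (N * \<bar>y\<bar>) + 16 * N"
      using N by linarith
    then show ?thesis
      using D by (intro divide_right_mono) (auto simp: algebra_simps)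
  qed
  also have "\<dots> \<le> (4 * \<bar>y\<bar> + 1) * D / D"
    using D by (intro divide_right_mono mult_left_mono) auto
  finally show ?thesis using D by (simp add: y_def N_def)
qed

lemma expectation_size_dev_square_le:
  assumes "n \<ge> 2"
  shows "measure_pmf.expectation (pruned_size n) (\<lambda>m. (size_dev n m)\<^sup>2) \<le> real n"
proof -
  let ?E = "measure_pmf.expectation (pruned_size n)"
  have "?E (\<lambda>m. (size_dev n m)\<^sup>2)
      = ?E (stein_weight n) + real n / (8 * real n - 12) * ?E (size_dev n)"
    using pruned_size_stein_identity[OF assms, of "size_dev n"] by (simp add: power2_eq_square)
  also have "?E (stein_weight n) \<le> ?E (\<lambda>_. real n / 2)"
    using assms by (intro expectation_pruned_size_mono stein_weight_le)
  also have "real n / (8 * real n - 12) * ?E (size_dev n) \<le> 1 / 2 * (real n / 4)"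
  proof -
    have "?E (size_dev n) \<le> ?E (\<lambda>_. real n / 4)"
      using assms by (intro expectation_pruned_size_mono) auto
    then have "real n / (8 * real n - 12) * ?E (size_dev n)
        \<le> real n / (8 * real n - 12) * (real n / 4)"
      using assms by (intro mult_left_mono) auto
    also have "\<dots> \<le> 1 / 2 * (real n / 4)"
      using assms by (intro mult_right_mono) (auto simp: divide_le_eq)
    finally show ?thesis .
  qed
  finally show ?thesis by simp
qed

lemma expectation_abs_size_dev_le:
  assumes "n \<ge> 2"
  shows "measure_pmf.expectation (pruned_size n) (\<lambda>m. \<bar>size_dev n m\<bar>) \<le> sqrt (real n)"
proof -
  have "measure_pmf.expectation (pruned_size n) (\<lambda>m. \<bar>size_dev n m\<bar>)
      \<le> sqrt (measure_pmf.expectation (pruned_size n) (\<lambda>m. (size_dev n m)\<^sup>2))"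
    using assms by (intro measure_pmf.expectation_abs_le_sqrt) auto
  also have "\<dots> \<le> sqrt (real n)"
    using expectation_size_dev_square_le[OF assms] by simp
  finally show ?thesis .
qed

lemma expectation_abs_stein_weight_diff_le:
  assumes "n \<ge> 2"
  shows "measure_pmf.expectation (pruned_size n) (\<lambda>m. \<bar>stein_weight n m - real n / 16\<bar>)
    \<le> 5 * sqrt (real n)"
proof -
  let ?E = "measure_pmf.expectation (pruned_size n)"
  have "?E (\<lambda>m. \<bar>stein_weight n m - real n / 16\<bar>) \<le> ?E (\<lambda>m. 4 * \<bar>size_dev n m\<bar> + 1)"
    using assms by (intro expectation_pruned_size_mono abs_stein_weight_diff_le)
  also have "\<dots> = 4 * ?E (\<lambda>m. \<bar>size_dev n m\<bar>) + 1"
    using assms by simp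
  also have "\<dots> \<le> 4 * sqrt (real n) + sqrt (real n)"
    using assms by (intro add_mono mult_left_mono expectation_abs_size_dev_le) auto
  finally show ?thesis by simp
qed

lemma norm_expectation_iexp_size_dev_diff_gauss_le:
  assumes n: "n \<ge> 2" and T: "\<bar>\<theta>\<bar> * sqrt (real n) \<le> T"
  shows "norm (measure_pmf.expectation (pruned_size n) (\<lambda>m. iexp (\<theta> * size_dev n m))
      - of_real (gauss (real n / 16) \<theta>)) \<le> (1 + 5 * T + T\<^sup>2) * \<bar>\<theta>\<bar>"
proof -
  let ?E = "measure_pmf.expectation (pruned_size n) :: (nat \<Rightarrow> real) \<Rightarrow> real"
  define c where "c = real n / (8 * real n - 12)"
  have shift: "size_dev n (Suc m) = size_dev n m + 1" for m
    by simp
  have "norm (measure_pmf.expectation (pruned_size n) (\<lambda>m. iexp (\<theta> * size_dev n m))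
      - of_real (gauss (real n / 16) \<theta>))
      \<le> (\<bar>c\<bar> + \<bar>\<theta>\<bar> * ?E (\<lambda>m. \<bar>stein_weight n m - real n / 16\<bar>)
          + \<theta>\<^sup>2 / 2 * ?E (\<lambda>m. \<bar>stein_weight n m\<bar>)) * \<bar>\<theta>\<bar>"
  proof (rule measure_pmf.norm_expectation_iexp_diff_gauss_le)
    show "measure_pmf.expectation (pruned_size n)
        (\<lambda>m. of_real (size_dev n m) * iexp (x * size_dev n m))
      = measure_pmf.expectation (pruned_size n) (\<lambda>m. of_real (stein_weight n m) *
          (iexp (x * (size_dev n m + 1)) - iexp (x * size_dev n m)))
        + of_real c * measure_pmf.expectation (pruned_size n) (\<lambda>m. iexp (x * size_dev n m))" for x
      using pruned_size_stein_identity[OF n, of "\<lambda>m. iexp (x * size_dev n m)"]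
      by (simp only: c_def shift scaleR_conv_of_real)
  qed (use n in auto)
  also have "\<dots> \<le> (1 + 5 * T + T\<^sup>2) * \<bar>\<theta>\<bar>"
  proof (intro mult_right_mono add_mono)
    show "\<bar>c\<bar> \<le> 1" using n by (simp add: c_def divide_le_eq)
    have "\<bar>\<theta>\<bar> * ?E (\<lambda>m. \<bar>stein_weight n m - real n / 16\<bar>) \<le> \<bar>\<theta>\<bar> * (5 * sqrt (real n))"
      using n by (intro mult_left_mono expectation_abs_stein_weight_diff_le) auto
    then show "\<bar>\<theta>\<bar> * ?E (\<lambda>m. \<bar>stein_weight n m - real n / 16\<bar>) \<le> 5 * T"
      using T by simp
    have "?E (\<lambda>m. \<bar>stein_weight n m\<bar>) \<le> ?E (\<lambda>_. real n / 2)"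
      using n by (intro expectation_pruned_size_mono)
        (simp_all only: abs_of_nonneg stein_weight_nonneg stein_weight_le)
    then have "\<theta>\<^sup>2 / 2 * ?E (\<lambda>m. \<bar>stein_weight n m\<bar>) \<le> \<theta>\<^sup>2 * real n"
      by (intro mult_mono) auto
    also have "\<dots> = (\<bar>\<theta>\<bar> * sqrt (real n))\<^sup>2"
      by (simp add: power_mult_distrib)
    also have "\<dots> \<le> T\<^sup>2"
      using T by (intro power_mono) auto
    finally show "\<theta>\<^sup>2 / 2 * ?E (\<lambda>m. \<bar>stein_weight n m\<bar>) \<le> T\<^sup>2" .
  qed auto
  finally show ?thesis .
qed

subsection \<open>Characteristic functions of the branch counts\<close>

text \<open>Here and in \<open>branch_var\<close>, the index \<open>r\<close> counts prunings and belongs to branches of order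
  \<open>r + 1\<close>.\<close>
definition branch_char :: "nat \<Rightarrow> nat \<Rightarrow> real \<Rightarrow> complex" where
  "branch_char r n \<theta> =
    measure_pmf.expectation (P n) (\<lambda>t. iexp (\<theta> * (real (S (Suc r) t) - real n / 4 ^ r)))"

definition branch_var :: "nat \<Rightarrow> real" where
  "branch_var r = 1 / 3 * ((4 ^ r - 1) / 16 ^ r)"

abbreviation branch_char_error :: "nat \<Rightarrow> nat \<Rightarrow> real \<Rightarrow> real" where
  "branch_char_error r n \<theta> \<equiv> norm (branch_char r n \<theta> - of_real (gauss (branch_var r * real n) \<theta>))"

lemma branch_var_nonneg: "branch_var r \<ge> 0"
  by (simp add: branch_var_def)

lemma branch_var_Suc: "branch_var (Suc r) = branch_var r / 4 + 1 / 16 ^ Suc r"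
  by (simp add: branch_var_def field_simps)

lemma branch_char_0:
  assumes "n > 0"
  shows "branch_char 0 n \<theta> = 1"
proof -
  have "branch_char 0 n \<theta> = measure_pmf.expectation (P n) (\<lambda>_. 1)"
    unfolding branch_char_def using assms
    by (intro integral_cong_AE)
      (auto simp: AE_measure_pmf_iff set_pmf_P mem_Omega S_1_eq_leaves[unfolded One_nat_def])
  then show ?thesis by simp
qed

lemma branch_char_1: "branch_char r 1 \<theta> = iexp (\<theta> * (real (S (Suc r) Leaf) - 1 / 4 ^ r))"
  by (simp add: branch_char_def P_def pmf_of_set_singleton)

lemma branch_char_Suc:
  assumes "n \<ge> 2"
  shows "branch_char (Suc r) n \<theta> = measure_pmf.expectation (pruned_size n)
    (\<lambda>m. iexp (\<theta> / 4 ^ r * size_dev n m) * branch_char r m \<theta>)"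
proof -
  let ?h = "\<lambda>s. iexp (\<theta> * (real (S (Suc r) s) - real n / 4 ^ Suc r))"
  have given_size: "measure_pmf.expectation (P m) ?h
      = iexp (\<theta> / 4 ^ r * size_dev n m) * branch_char r m \<theta>" for m
  proof -
    have "\<theta> * (c - real n / 4 ^ Suc r) = \<theta> / 4 ^ r * size_dev n m + \<theta> * (c - real m / 4 ^ r)" for c
      by (simp add: field_simps)
    then have "?h s = iexp (\<theta> / 4 ^ r * size_dev n m)
        * iexp (\<theta> * (real (S (Suc r) s) - real m / 4 ^ r))" for s
      by (simp only: of_real_add distrib_left exp_add)
    then show ?thesis
      by (simp only: branch_char_def integral_mult_right_zero)
  qed
  have "branch_char (Suc r) n \<theta> = measure_pmf.expectation (P n) (\<lambda>t. ?h (prune t))"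
    unfolding branch_char_def
  proof (intro integral_cong_AE)
    show "AE t in measure_pmf (P n).
        iexp (\<theta> * (real (S (Suc (Suc r)) t) - real n / 4 ^ Suc r)) = ?h (prune t)"
    proof -
      have "S (Suc (Suc r)) t = S (Suc r) (prune t)" if "t \<in> Omega n" for t
        using that assms by (intro S_Suc_prune) (auto simp: mem_Omega)
      then show ?thesis
        using assms by (simp add: AE_measure_pmf_iff set_pmf_P)
    qed
  qed auto
  also have "\<dots> = measure_pmf.expectation (bind_pmf (pruned_size n) P) ?h"
    by (simp flip: map_pmf_prune[OF assms])
  also have "\<dots> = measure_pmf.expectation (pruned_size n) (\<lambda>m. measure_pmf.expectation (P m) ?h)"
    using assms by (intro expectation_bind_pmf_finite)
      (auto simp: set_pmf_P set_pmf_pruned_size)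
  also have "\<dots> = measure_pmf.expectation (pruned_size n)
      (\<lambda>m. iexp (\<theta> / 4 ^ r * size_dev n m) * branch_char r m \<theta>)"
    by (simp only: given_size)
  finally show ?thesis .
qed

lemma branch_char_error_1_le:
  assumes "\<bar>\<theta>\<bar> \<le> T"
  shows "branch_char_error r 1 \<theta> \<le> (1 + branch_var r * T / 2) * \<bar>\<theta>\<bar>"
proof -
  define x where "x = \<theta> * (real (S (Suc r) Leaf) - 1 / 4 ^ r)"
  have "norm (branch_char r 1 \<theta> - 1) \<le> \<bar>x\<bar>"
    using norm_iexp_diff_le[of x 0] unfolding branch_char_1 x_def by simp
  also have "\<dots> \<le> \<bar>\<theta>\<bar> * 1"
    unfolding x_def abs_mult by (intro mult_left_mono) (auto simp: S_def abs_le_iff)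
  finally have "norm (branch_char r 1 \<theta> - 1) \<le> \<bar>\<theta>\<bar>" by simp
  moreover have "norm (1 - of_real (gauss (branch_var r) \<theta>) :: complex)
      \<le> branch_var r * T / 2 * \<bar>\<theta>\<bar>"
  proof -
    have "norm (1 - of_real (gauss (branch_var r) \<theta>) :: complex) \<le> branch_var r * \<theta>\<^sup>2 / 2"
      using norm_gauss_diff_le[of 0 "branch_var r" \<theta>] branch_var_nonneg[of r] by simp
    also have "\<dots> = branch_var r * \<bar>\<theta>\<bar> / 2 * \<bar>\<theta>\<bar>"
      by (simp add: power2_eq_square)
    also have "\<dots> \<le> branch_var r * T / 2 * \<bar>\<theta>\<bar>"
      using assms branch_var_nonneg[of r]
      by (intro mult_right_mono divide_right_mono mult_left_mono) auto
    finally show ?thesis .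
  qed
  ultimately show ?thesis
    using norm_diff_triangle_le[of "branch_char r 1 \<theta>" 1] by (simp add: distrib_right)
qed

lemma gauss_branch_var_Suc:
  "gauss (branch_var (Suc r) * x) \<theta> = gauss (x / 16) (\<theta> / 4 ^ r) * gauss (branch_var r * (x / 4)) \<theta>"
proof -
  have "branch_var (Suc r) * x = x / 16 / (4 ^ r)\<^sup>2 + branch_var r * (x / 4)"
    by (simp add: branch_var_Suc power2_eq_square field_simps flip: power_mult_distrib)
  then show ?thesis
    by (simp only: gauss_add_left gauss_divide_right)
qed

lemma expectation_branch_char_diff_le:
  assumes n: "n \<ge> 2" and T: "\<bar>\<theta>\<bar> * sqrt (real n) \<le> T"
    and approx: "\<And>m. 0 < m \<Longrightarrow> \<bar>\<theta>\<bar> * sqrt (real m) \<le> T \<Longrightarrow>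
      branch_char_error r m \<theta> \<le> C * \<bar>\<theta>\<bar>"
  shows "measure_pmf.expectation (pruned_size n)
      (\<lambda>m. norm (branch_char r m \<theta> - of_real (gauss (branch_var r * (real n / 4)) \<theta>)))
    \<le> (C + branch_var r * T / 2) * \<bar>\<theta>\<bar>"
proof -
  let ?E = "measure_pmf.expectation (pruned_size n)"
  define v g where "v = branch_var r" and "g = gauss (v * (real n / 4)) \<theta>"
  have v: "v \<ge> 0" by (simp add: v_def branch_var_nonneg)
  have "?E (\<lambda>m. norm (branch_char r m \<theta> - of_real g))
      \<le> ?E (\<lambda>m. C * \<bar>\<theta>\<bar> + v * \<theta>\<^sup>2 / 2 * \<bar>size_dev n m\<bar>)"
  proof (rule expectation_pruned_size_mono[OF n])
    fix m assume m: "0 < m" "2 * m \<le> n"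
    have "\<bar>\<theta>\<bar> * sqrt (real m) \<le> \<bar>\<theta>\<bar> * sqrt (real n)"
      using m by (intro mult_left_mono) auto
    with T m(1) have "norm (branch_char r m \<theta> - of_real (gauss (v * real m) \<theta>)) \<le> C * \<bar>\<theta>\<bar>"
      unfolding v_def by (intro approx) auto
    moreover have "norm (of_real (gauss (v * real m) \<theta>) - of_real g :: complex)
        \<le> v * \<theta>\<^sup>2 / 2 * \<bar>size_dev n m\<bar>"
    proof -
      have "norm (of_real (gauss (v * real m) \<theta>) - of_real g :: complex)
          \<le> \<bar>v * real m - v * (real n / 4)\<bar> * \<theta>\<^sup>2 / 2"
        unfolding g_def using v by (intro norm_gauss_diff_le) auto
      also have "\<dots> = v * \<theta>\<^sup>2 / 2 * \<bar>size_dev n m\<bar>"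
        unfolding right_diff_distrib[symmetric] abs_mult using v by simp
      finally show ?thesis .
    qed
    ultimately show "norm (branch_char r m \<theta> - of_real g) \<le> C * \<bar>\<theta>\<bar> + v * \<theta>\<^sup>2 / 2 * \<bar>size_dev n m\<bar>"
      by (rule norm_diff_triangle_le)
  qed
  also have "\<dots> = C * \<bar>\<theta>\<bar> + v * \<theta>\<^sup>2 / 2 * ?E (\<lambda>m. \<bar>size_dev n m\<bar>)"
    using n by simp
  also have "\<dots> \<le> C * \<bar>\<theta>\<bar> + v * \<theta>\<^sup>2 / 2 * sqrt (real n)"
    using v n by (intro add_left_mono mult_left_mono expectation_abs_size_dev_le) auto
  also have "v * \<theta>\<^sup>2 / 2 * sqrt (real n) = v / 2 * \<bar>\<theta>\<bar> * (\<bar>\<theta>\<bar> * sqrt (real n))"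
    by (simp add: power2_eq_square)
  also have "\<dots> \<le> v / 2 * \<bar>\<theta>\<bar> * T"
    using v T by (intro mult_left_mono) auto
  finally show ?thesis
    by (simp add: v_def g_def algebra_simps)
qed

lemma branch_char_error_Suc_le:
  assumes n: "n \<ge> 2" and T: "\<bar>\<theta>\<bar> * sqrt (real n) \<le> T"
    and approx: "\<And>m. 0 < m \<Longrightarrow> \<bar>\<theta>\<bar> * sqrt (real m) \<le> T \<Longrightarrow>
      branch_char_error r m \<theta> \<le> C * \<bar>\<theta>\<bar>"
  shows "branch_char_error (Suc r) n \<theta>
    \<le> (C + branch_var r * T / 2 + (1 + 5 * T + T\<^sup>2)) * \<bar>\<theta>\<bar>"
proof -
  let ?E = "measure_pmf.expectation (pruned_size n)"
  define \<phi> where "\<phi> = \<theta> / 4 ^ r"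
  define Z where "Z m = iexp (\<phi> * size_dev n m)" for m
  define g h where "g = gauss (branch_var r * (real n / 4)) \<theta>" and "h = gauss (real n / 16) \<phi>"
  have \<phi>: "\<bar>\<phi>\<bar> \<le> \<bar>\<theta>\<bar>"
    by (simp add: \<phi>_def divide_le_eq mult_le_cancel_left1)
  have "branch_char_error (Suc r) n \<theta>
      = norm (?E (\<lambda>m. Z m * branch_char r m \<theta>) - of_real h * of_real g)"
    by (simp only: branch_char_Suc[OF n] gauss_branch_var_Suc of_real_mult g_def h_def \<phi>_def Z_def)
  also have "\<dots> \<le> ?E (\<lambda>m. norm (branch_char r m \<theta> - of_real g)) + norm (?E Z - of_real h)"
    using n branch_var_nonneg[of r]
    by (intro measure_pmf.norm_expectation_mult_diff_le) (auto simp: Z_def g_def abs_gauss_le_1)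
  also have "\<dots> \<le> (C + branch_var r * T / 2) * \<bar>\<theta>\<bar> + (1 + 5 * T + T\<^sup>2) * \<bar>\<theta>\<bar>"
  proof (rule add_mono)
    show "?E (\<lambda>m. norm (branch_char r m \<theta> - of_real g)) \<le> (C + branch_var r * T / 2) * \<bar>\<theta>\<bar>"
      unfolding g_def using n T approx by (rule expectation_branch_char_diff_le)
    have "\<bar>\<phi>\<bar> * sqrt (real n) \<le> T"
      using T \<phi> by (meson mult_right_mono order_trans real_sqrt_ge_zero of_nat_0_le_iff)
    then have "norm (?E Z - of_real h) \<le> (1 + 5 * T + T\<^sup>2) * \<bar>\<phi>\<bar>"
      unfolding h_def Z_def by (rule norm_expectation_iexp_size_dev_diff_gauss_le[OF n])
    also have "\<dots> \<le> (1 + 5 * T + T\<^sup>2) * \<bar>\<theta>\<bar>"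
      using \<phi> order_trans[OF _ T, of 0] by (intro mult_left_mono) auto
    finally show "norm (?E Z - of_real h) \<le> (1 + 5 * T + T\<^sup>2) * \<bar>\<theta>\<bar>" .
  qed
  finally show ?thesis
    by (simp only: distrib_right)
qed

text \<open>The error is linear in \<open>\<theta>\<close> and uniform over all sizes with \<open>|\<theta>| sqrt n \<le> T\<close>; this region is
  stable under passing to smaller trees, which is what lets the induction condition on the pruned
  tree.\<close>
lemma branch_char_error_le:
  obtains C where "\<And>n \<theta>. n > 0 \<Longrightarrow> \<bar>\<theta>\<bar> * sqrt (real n) \<le> T \<Longrightarrow>
    branch_char_error r n \<theta> \<le> C * \<bar>\<theta>\<bar>"
proof (induction r arbitrary: thesis)
  case 0
  show ?case
    by (rule 0[of 0]) (simp add: branch_char_0 branch_var_def)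
next
  case (Suc r)
  obtain C where C: "\<And>n \<theta>. n > 0 \<Longrightarrow> \<bar>\<theta>\<bar> * sqrt (real n) \<le> T \<Longrightarrow>
    branch_char_error r n \<theta> \<le> C * \<bar>\<theta>\<bar>"
    using Suc.IH by blast
  define C_leaf where "C_leaf = 1 + branch_var (Suc r) * T / 2"
  define C_node where "C_node = C + branch_var r * T / 2 + (1 + 5 * T + T\<^sup>2)"
  have "branch_char_error (Suc r) n \<theta> \<le> max C_leaf C_node * \<bar>\<theta>\<bar>"
    if n: "n > 0" and T: "\<bar>\<theta>\<bar> * sqrt (real n) \<le> T" for n \<theta>
  proof (cases "n = 1")
    case True
    then have "branch_char_error (Suc r) n \<theta> \<le> C_leaf * \<bar>\<theta>\<bar>"
      using T branch_char_error_1_le[of \<theta> T "Suc r"] by (simp add: C_leaf_def)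
    also have "\<dots> \<le> max C_leaf C_node * \<bar>\<theta>\<bar>" by (intro mult_right_mono) auto
    finally show ?thesis .
  next
    case False
    then have "branch_char_error (Suc r) n \<theta> \<le> C_node * \<bar>\<theta>\<bar>"
      unfolding C_node_def using n T C by (intro branch_char_error_Suc_le) auto
    also have "\<dots> \<le> max C_leaf C_node * \<bar>\<theta>\<bar>" by (intro mult_right_mono) auto
    finally show ?thesis .
  qed
  then show ?case by (rule Suc.prems)
qed

subsection \<open>Convergence in distribution\<close>

lemma branch_char_tendsto:
  "(\<lambda>n. branch_char r n (x / sqrt (real n))) \<longlonglongrightarrow> of_real (gauss (branch_var r) x)"
proof -
  obtain C where C: "\<And>n \<theta>. n > 0 \<Longrightarrow> \<bar>\<theta>\<bar> * sqrt (real n) \<le> \<bar>x\<bar> \<Longrightarrow>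
    branch_char_error r n \<theta> \<le> C * \<bar>\<theta>\<bar>"
    using branch_char_error_le[of "\<bar>x\<bar>" r] by blast
  have "norm (branch_char r n (x / sqrt (real n)) - of_real (gauss (branch_var r) x))
      \<le> C * \<bar>x\<bar> / sqrt (real n)" if "n > 0" for n
    using C[OF that, of "x / sqrt (real n)"] that by (simp add: gauss_divide_right)
  then have "\<forall>\<^sub>F n in sequentially.
      norm (branch_char r n (x / sqrt (real n)) - of_real (gauss (branch_var r) x))
        \<le> C * \<bar>x\<bar> / sqrt (real n)"
    by (rule eventually_mono[OF eventually_gt_at_top[of 0]])
  moreover have "(\<lambda>n. C * \<bar>x\<bar> / sqrt (real n)) \<longlonglongrightarrow> 0"
    by real_asymp
  ultimately show ?thesis
    by (rule LIM_zero_cancel[OF Lim_null_comparison])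
qed

lemma char_distr_branch_count:
  assumes "n > 0"
  shows "char (distr (measure_pmf (P n)) borel
      (\<lambda>t. sqrt (real n) * (real (S (Suc r) t) / real n - 1 / 4 ^ r))) x
    = branch_char r n (x / sqrt (real n))"
proof -
  have "x * (sqrt (real n) * (c / real n - 1 / 4 ^ r))
      = x / sqrt (real n) * (c - real n / 4 ^ r)" for c
  proof -
    have "sqrt (real n) * (c / real n - 1 / 4 ^ r)
        = real n * (c / real n - 1 / 4 ^ r) / sqrt (real n)"
      by (metis real_div_sqrt of_nat_0_le_iff times_divide_eq_left)
    also have "real n * (c / real n - 1 / 4 ^ r) = c - real n / 4 ^ r"
      using assms by (simp add: right_diff_distrib)
    finally show ?thesis by simp
  qed
  then show ?thesis
    unfolding char_def branch_char_def by (subst integral_distr) simp_all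
qed

theorem theorem3:
  fixes r :: nat
  assumes "r \<ge> 1"
  shows "weak_conv_m
           (\<lambda>n. distr (measure_pmf (P n)) borel
                  (\<lambda>t. sqrt (real n) * (real (S (r + 1) t) / real n - 1 / 4 ^ r)))
           (density lborel (normal_density 0 (sqrt ((1 / 3) * ((4 ^ r - 1) / 16 ^ r)))))"
  unfolding branch_var_def[symmetric]
proof (rule levy_continuity)
  let ?M = "\<lambda>n. distr (measure_pmf (P n)) borel
    (\<lambda>t. sqrt (real n) * (real (S (r + 1) t) / real n - 1 / 4 ^ r))"
  have "(1::real) < 4 ^ r" using assms by simp
  then have pos: "branch_var r > 0" by (simp add: branch_var_def)
  show "real_distribution (density lborel (normal_density 0 (sqrt (branch_var r))))"
    using pos by (auto simp: real_distribution_def real_distribution_axioms_def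
        intro!: prob_space_normal_density)
  show "real_distribution (?M n)" for n
    by (intro prob_space.real_distribution_distr measure_pmf.prob_space_axioms) simp
  have "\<forall>\<^sub>F n in sequentially. branch_char r n (x / sqrt (real n)) = char (?M n) x" for x
    using eventually_gt_at_top[of 0] by eventually_elim (simp add: char_distr_branch_count)
  from Lim_transform_eventually[OF branch_char_tendsto this]
  show "(\<lambda>n. char (?M n) x)
      \<longlonglongrightarrow> char (density lborel (normal_density 0 (sqrt (branch_var r)))) x" for x
    using pos by (simp add: char_centered_normal)
qed

end
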